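(* Fix $d\geq2$, and for odd $N$ let $P_N^{(d)}=\{(t,t_1^2+\cdots+t_{d-1}^2):t\in\mathbb Z_N^{d-1}\}\subseteq\mathbb Z_N^d$. As $N$ tends to infinity through any family of odd moduli, $$\operatorname{FR}(1_{P_N^{(d)}})=N^{\frac{d}{2}-o(1)},\qquad \kappa_N(1_{P_N^{(d)}})\longrightarrow0 .$$
   Context: $\mathbb Z_N=\mathbb Z/N\mathbb Z$. For $f:\mathbb Z_N^d\to\mathbb C$ the unitary Fourier transform is $\widehat f(\xi)=N^{-d/2}\sum_{x\in\mathbb Z_N^d}f(x)e^{-2\pi i x\cdot\xi/N}$. Norms use counting measure: $\|f\|_r=(\sum_x|f(x)|^r)^{1/r}$. $1_S$ is the indicator of $S$. For $f\neq0$, $\operatorname{FR}(f)=\|\widehat f\|_1/\|\widehat f\|_2$ and $\kappa_N(f)=\log\bigl(N^{d/2}/\operatorname{FR}(f)\bigr)/\log N$. $o(1)$ denotes a quantity tending to zero as $N\to\infty$ within the family. *)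

theory Defs
  imports Complex_Main "HOL-Library.FuncSet" "HOL-Library.Indicator_Function"
begin

text \<open>
  Since the modulus \<open>N\<close> varies, \<open>\<int>\<^sub>N\<close> is represented by the least nonnegative residues
  \<open>{0..<int N}\<close>, and a vector in \<open>\<int>\<^sub>N\<close> to the power \<open>d\<close> by an extensional function on the
  coordinate set \<open>{..<d}\<close>.
\<close>

definition ZN_vecs :: "nat \<Rightarrow> nat \<Rightarrow> (nat \<Rightarrow> int) set" where
  "ZN_vecs N d = {..<d} \<rightarrow>\<^sub>E {0..<int N}"

definition fourier :: "nat \<Rightarrow> nat \<Rightarrow> ((nat \<Rightarrow> int) \<Rightarrow> complex) \<Rightarrow> (nat \<Rightarrow> int) \<Rightarrow> complex" where
  "fourier N d f \<xi> =
     of_real (real N powr (- real d / 2)) *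
     (\<Sum>x\<in>ZN_vecs N d.
        f x * exp (- 2 * of_real pi * \<i> * of_int (\<Sum>i<d. x i * \<xi> i) / of_nat N))"

definition lp_norm :: "nat \<Rightarrow> nat \<Rightarrow> real \<Rightarrow> ((nat \<Rightarrow> int) \<Rightarrow> complex) \<Rightarrow> real" where
  "lp_norm N d r f = (\<Sum>x\<in>ZN_vecs N d. cmod (f x) powr r) powr (1 / r)"

definition FR :: "nat \<Rightarrow> nat \<Rightarrow> ((nat \<Rightarrow> int) \<Rightarrow> complex) \<Rightarrow> real" where
  "FR N d f = lp_norm N d 1 (fourier N d f) / lp_norm N d 2 (fourier N d f)"

text \<open>For \<open>N = 1\<close> the denominator \<open>ln N\<close> vanishes and the value below is \<open>0\<close> by convention.\<close>

definition kappa :: "nat \<Rightarrow> nat \<Rightarrow> ((nat \<Rightarrow> int) \<Rightarrow> complex) \<Rightarrow> real" where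
  "kappa N d f = ln (real N powr (real d / 2) / FR N d f) / ln (real N)"

text \<open>The coordinates \<open>0, \<dots>, d - 2\<close> carry \<open>t\<close>; the last coordinate, with index \<open>d - 1\<close>,
  carries the sum of squares reduced modulo \<open>N\<close>.\<close>

definition paraboloid :: "nat \<Rightarrow> nat \<Rightarrow> (nat \<Rightarrow> int) set" where
  "paraboloid N d =
     (\<lambda>t. t(d - 1 := (\<Sum>i<d - 1. (t i)\<^sup>2) mod int N)) ` ZN_vecs N (d - 1)"

lemma paraboloid_subset:
  assumes "d \<ge> 1" and "N > 0"
  shows "paraboloid N d \<subseteq> ZN_vecs N d"
  using assms by (fastforce simp: paraboloid_def ZN_vecs_def PiE_iff extensional_def)

end

(* The Fourier coefficient of the indicator at (eta, s) is N^(-d/2) times a product of d - 1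
   quadratic Gauss sums G(s, eta_i). Parseval in one variable gives the L2 norm N^((d-1)/2).
   When s is a unit modulo the odd N, every G(s, eta) has modulus sqrt N, so these s alone
   contribute phi(N) N^(d - 3/2) to the L1 norm; hence FR >= phi(N) N^(d/2 - 1), while
   Cauchy-Schwarz gives FR <= N^(d/2). Comparing the prime factors of N with 2, 3, 4, ... yields
   phi(N) / N >= 1 / (1 + log 2 N), so kappa lies between 0 and ln (1 + log 2 N) / ln N. *)

theory Submission
  imports Defs "HOL-Analysis.Analysis" "HOL-Number_Theory.Totient" "HOL-Real_Asymp.Real_Asymp"
begin

section \<open>Additive characters modulo \<open>N\<close>\<close>

text \<open>The Fourier kernel as a function of the integer dot product; periodicity modulo
  \<open>N\<close> enters only through \<open>zchar_cong\<close>.\<close>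

definition zchar :: "nat \<Rightarrow> int \<Rightarrow> complex" where
  "zchar N k = exp (- 2 * of_real pi * \<i> * of_int k / of_nat N)"

lemma zchar_add: "zchar N (a + b) = zchar N a * zchar N b"
  unfolding zchar_def mult_exp_exp by (simp add: algebra_simps add_divide_distrib diff_divide_distrib)

lemma zchar_0 [simp]: "zchar N 0 = 1"
  by (simp add: zchar_def)

lemma zchar_sum: "zchar N (\<Sum>i\<in>A. f i) = (\<Prod>i\<in>A. zchar N (f i))"
  by (induction A rule: infinite_finite_induct) (simp_all add: zchar_add)

lemma cnj_zchar: "cnj (zchar N a) = zchar N (- a)"
  by (simp add: zchar_def exp_cnj)

lemma norm_zchar [simp]: "cmod (zchar N a) = 1"
  by (simp add: zchar_def)

lemma zchar_eq_1_iff: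
  assumes "N > 0"
  shows "zchar N k = 1 \<longleftrightarrow> int N dvd k"
proof -
  have "zchar N k = 1 \<longleftrightarrow> (\<exists>n::int. - (2 * pi * of_int k / real N) = 2 * of_int n * pi)"
    by (simp add: zchar_def exp_eq_1)
  \<comment> \<open>The sign in \<open>- n\<close> comes from the minus sign in the Fourier
    kernel.\<close>
  also have "\<dots> \<longleftrightarrow> (\<exists>n. k = int N * (- n))"
  proof (intro ex_cong1)
    fix n :: int
    have "- (2 * pi * of_int k / real N) = 2 * of_int n * pi \<longleftrightarrow>
        pi * real_of_int k = pi * real_of_int (int N * (- n))"
      using assms by (auto simp: field_simps)
    also have "\<dots> \<longleftrightarrow> real_of_int k = real_of_int (int N * (- n))"
      by (subst mult_cancel_left) simp
    finally show "- (2 * pi * of_int k / real N) = 2 * of_int n * pi \<longleftrightarrow> k = int N * (- n)"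
      by (simp only: of_int_eq_iff)
  qed
  also have "\<dots> \<longleftrightarrow> int N dvd k"
    unfolding dvd_def by (metis minus_minus)
  finally show ?thesis .
qed

lemma zchar_cong:
  assumes "N > 0" "a mod int N = b mod int N"
  shows "zchar N a = zchar N b"
proof -
  have "zchar N (a - b) = 1"
    using assms by (simp add: zchar_eq_1_iff mod_eq_dvd_iff)
  then show ?thesis
    using zchar_add[of N b "a - b"] by simp
qed

text \<open>Translation by \<open>h\<close> permutes the residues, and periodicity of
  \<open>F\<close> hides the reduction modulo \<open>n\<close>.\<close>

lemma sum_mod_shift:
  fixes F :: "int \<Rightarrow> 'a::comm_monoid_add"
  assumes "n > 0" "\<And>x y. x mod n = y mod n \<Longrightarrow> F x = F y"
  shows "(\<Sum>t\<in>{0..<n}. F (t + h)) = (\<Sum>t\<in>{0..<n}. F t)"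
proof (rule sum.reindex_bij_witness[where i = "\<lambda>t. (t - h) mod n" and j = "\<lambda>t. (t + h) mod n"])
  fix t assume "t \<in> {0..<n}"
  then show "((t + h) mod n - h) mod n = t" "((t - h) mod n + h) mod n = t"
    by (simp_all add: mod_simps)
  show "F ((t + h) mod n) = F (t + h)"
    by (rule assms(2)) simp
qed (use assms(1) in auto)

text \<open>Orthogonality of characters: shifting \<open>t\<close> by 1 multiplies the sum by
  \<open>zchar N k\<close>, so the sum vanishes unless this factor is 1.\<close>

lemma sum_zchar:
  assumes "N > 0"
  shows "(\<Sum>t\<in>{0..<int N}. zchar N (k * t)) = (if int N dvd k then of_nat N else 0)"
proof (cases "int N dvd k")
  case True
  then have "zchar N (k * t) = 1" for t
    using assms by (simp add: zchar_eq_1_iff)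
  then show ?thesis
    using True by simp
next
  case False
  let ?S = "\<Sum>t\<in>{0..<int N}. zchar N (k * t)"
  have "zchar N k * ?S = (\<Sum>t\<in>{0..<int N}. zchar N (k * (t + 1)))"
    by (simp add: sum_distrib_left distrib_left zchar_add mult_ac)
  also have "\<dots> = ?S"
    by (rule sum_mod_shift) (use assms in \<open>auto intro!: zchar_cong intro: mod_mult_cong\<close>)
  finally have "(zchar N k - 1) * ?S = 0"
    by (simp add: algebra_simps)
  then show ?thesis
    using False assms by (simp add: zchar_eq_1_iff)
qed

section \<open>Quadratic Gauss sums\<close>

text \<open>The one-variable factor of the Fourier coefficient: \<open>s\<close> is the frequency of
  the last coordinate and multiplies the square, \<open>\<eta>\<close> is the frequency of one of
  the others.\<close>

definition gauss_sum :: "nat \<Rightarrow> int \<Rightarrow> int \<Rightarrow> complex" where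
  "gauss_sum N s \<eta> = (\<Sum>t\<in>{0..<int N}. zchar N (t * \<eta> + t\<^sup>2 * s))"

text \<open>Expanding the sum times its conjugate gives the common starting point for the evaluation
  at a single \<open>\<eta>\<close> and for the average over all \<open>\<eta>\<close>.\<close>

lemma norm_gauss_sum_sq:
  "of_real ((cmod (gauss_sum N s \<eta>))\<^sup>2) =
     (\<Sum>u\<in>{0..<int N}. \<Sum>t\<in>{0..<int N}. zchar N ((t - u) * \<eta> + (t\<^sup>2 - u\<^sup>2) * s))"
  unfolding complex_norm_square gauss_sum_def cnj_sum sum_product
  by (subst sum.swap) (simp add: cnj_zchar zchar_add [symmetric] algebra_simps)

text \<open>Weyl differencing: with \<open>t = h + u\<close> the exponent becomes linear in
  \<open>u\<close>, with coefficient \<open>2 * s * h\<close>. Orthogonality then leaves only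
  \<open>h = 0\<close>.\<close>

lemma norm_gauss_sum_coprime:
  assumes "odd N" "coprime s (int N)"
  shows "cmod (gauss_sum N s \<eta>) = sqrt (real N)"
proof -
  have N: "N > 0" using assms(1) by (rule odd_pos)
  let ?I = "{0..<int N}"
  \<comment> \<open>Oddness of \<open>N\<close> makes 2 a unit, hence also
    \<open>2 * s\<close>.\<close>
  have unit: "int N dvd 2 * s * h \<longleftrightarrow> h = 0" if "h \<in> ?I" for h
  proof -
    have "coprime (2 * s) (int N)"
      using assms by (simp add: coprime_left_2_iff_odd)
    then have "int N dvd 2 * s * h \<longleftrightarrow> int N dvd h"
      by (simp add: coprime_dvd_mult_right_iff coprime_commute)
    then show ?thesis
      using that by (auto dest: zdvd_imp_le simp: le_less)
  qed
  have "of_real ((cmod (gauss_sum N s \<eta>))\<^sup>2) =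
      (\<Sum>u\<in>?I. \<Sum>t\<in>?I. zchar N ((t - u) * \<eta> + (t\<^sup>2 - u\<^sup>2) * s))"
    by (rule norm_gauss_sum_sq)
  also have "\<dots> = (\<Sum>u\<in>?I. \<Sum>h\<in>?I. zchar N ((h + u - u) * \<eta> + ((h + u)\<^sup>2 - u\<^sup>2) * s))"
    using N by (intro sum.cong refl sum_mod_shift [symmetric] zchar_cong)
      (auto intro!: mod_add_cong mod_diff_cong mod_mult_cong simp: power2_eq_square)
  also have "\<dots> = (\<Sum>h\<in>?I. zchar N (h * \<eta> + h\<^sup>2 * s) * (\<Sum>u\<in>?I. zchar N (2 * s * h * u)))"
    by (subst sum.swap)
      (simp add: sum_distrib_left zchar_add [symmetric] algebra_simps power2_eq_square)
  also have "\<dots> = (\<Sum>h\<in>?I. if h = 0 then of_nat N else 0)"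
    using N by (intro sum.cong refl) (simp add: sum_zchar unit)
  also have "\<dots> = complex_of_real (real N)"
    using N by simp
  finally have "(cmod (gauss_sum N s \<eta>))\<^sup>2 = real N"
    unfolding of_real_eq_iff .
  then show ?thesis
    by (metis norm_ge_zero real_sqrt_unique)
qed

text \<open>For fixed \<open>s\<close> this is Parseval for the unimodular function
  \<open>zchar N (t\<^sup>2 * s)\<close>: summing over \<open>\<eta>\<close> first leaves the
  \<open>N\<close> diagonal terms \<open>t = u\<close>, each of weight \<open>N\<close>. Units and
  non-units \<open>s\<close> are treated alike, as the L2 norm requires.\<close>

lemma gauss_sum_parseval:
  assumes "N > 0"
  shows "(\<Sum>\<eta>\<in>{0..<int N}. (cmod (gauss_sum N s \<eta>))\<^sup>2) = (real N)\<^sup>2"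
proof -
  let ?I = "{0..<int N}"
  have "of_real (\<Sum>\<eta>\<in>?I. (cmod (gauss_sum N s \<eta>))\<^sup>2) =
      (\<Sum>\<eta>\<in>?I. \<Sum>u\<in>?I. \<Sum>t\<in>?I. zchar N ((t - u) * \<eta> + (t\<^sup>2 - u\<^sup>2) * s))"
    by (simp only: of_real_sum norm_gauss_sum_sq)
  also have "\<dots> = (\<Sum>u\<in>?I. \<Sum>\<eta>\<in>?I. \<Sum>t\<in>?I. zchar N ((t - u) * \<eta> + (t\<^sup>2 - u\<^sup>2) * s))"
    by (rule sum.swap)
  also have "\<dots> = (\<Sum>u\<in>?I. \<Sum>t\<in>?I. zchar N ((t\<^sup>2 - u\<^sup>2) * s) * (\<Sum>\<eta>\<in>?I. zchar N ((t - u) * \<eta>)))"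
    by (rule sum.cong[OF refl], subst sum.swap)
      (simp add: sum_distrib_left sum_distrib_right zchar_add mult_ac)
  also have "\<dots> = (\<Sum>u\<in>?I. \<Sum>t\<in>?I. if t = u then of_nat N else 0)"
  proof (intro sum.cong refl)
    fix u t assume "u \<in> ?I" "t \<in> ?I"
    then have "int N dvd t - u \<longleftrightarrow> t = u"
      by (simp add: mod_eq_dvd_iff [symmetric])
    then show "zchar N ((t\<^sup>2 - u\<^sup>2) * s) * (\<Sum>\<eta>\<in>?I. zchar N ((t - u) * \<eta>)) =
        (if t = u then of_nat N else 0)"
      using assms by (simp add: sum_zchar)
  qed
  also have "\<dots> = complex_of_real ((real N)\<^sup>2)"
    by (simp add: power2_eq_square)
  finally show ?thesis
    unfolding of_real_eq_iff .
qed

section \<open>Fourier transform of the paraboloid\<close>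

lemma finite_ZN_vecs [simp]: "finite (ZN_vecs N d)"
  by (simp add: ZN_vecs_def finite_PiE)

lemma card_ZN_vecs: "card (ZN_vecs N d) = N ^ d"
  by (simp add: ZN_vecs_def card_PiE)

lemma sum_ZN_vecs_prod:
  fixes h :: "int \<Rightarrow> 'a::comm_semiring_1"
  shows "(\<Sum>x\<in>ZN_vecs N d. \<Prod>i<d. h (x i)) = (\<Sum>y\<in>{0..<int N}. h y) ^ d"
  using prod_sum_PiE[of "{..<d}" "\<lambda>_. {0..<int N}" "\<lambda>_. h"] by (simp add: ZN_vecs_def)

text \<open>Splits off the frequency dual to the sum of squares; once it is fixed, the Fourier
  coefficient factors over the other coordinates.\<close>

lemma sum_ZN_vecs_Suc:
  fixes F :: "(nat \<Rightarrow> int) \<Rightarrow> 'a::comm_monoid_add"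
  shows "(\<Sum>x\<in>ZN_vecs N (Suc d). F x) = (\<Sum>s\<in>{0..<int N}. \<Sum>x\<in>ZN_vecs N d. F (x(d := s)))"
proof -
  have "inj_on (\<lambda>(s, x). x(d := s)) ({0..<int N} \<times> ZN_vecs N d)"
    unfolding ZN_vecs_def by (rule inj_combinator) simp
  then have "(\<Sum>x\<in>ZN_vecs N (Suc d). F x) =
      (\<Sum>(s, x)\<in>{0..<int N} \<times> ZN_vecs N d. F (x(d := s)))"
    unfolding ZN_vecs_def lessThan_Suc PiE_insert_eq
    by (subst sum.reindex) (auto simp: case_prod_unfold)
  then show ?thesis
    by (simp add: sum.cartesian_product)
qed

text \<open>Parametrising the paraboloid by \<open>t\<close> turns the phase into a sum of terms
  that each involve a single \<open>t i\<close>, so the exponential sum is a product. Writing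
  \<open>d\<close> as \<open>Suc m\<close> avoids truncated subtraction.\<close>

lemma fourier_indicator_paraboloid:
  assumes "N > 0"
  shows "fourier N (Suc m) (indicator (paraboloid N (Suc m))) \<xi> =
    of_real (real N powr (- real (Suc m) / 2)) * (\<Prod>i<m. gauss_sum N (\<xi> m) (\<xi> i))"
proof -
  let ?lift = "\<lambda>t. t(m := (\<Sum>i<m. (t i)\<^sup>2) mod int N)"
  have P: "paraboloid N (Suc m) = ?lift ` ZN_vecs N m"
    by (simp add: paraboloid_def)
  have inj: "inj_on ?lift (ZN_vecs N m)"
  proof (rule inj_onI)
    fix t u assume tu: "t \<in> ZN_vecs N m" "u \<in> ZN_vecs N m" "?lift t = ?lift u"
    have "t i = u i" if "i < m" for i
      using fun_cong[OF tu(3), of i] that by simp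
    then show "t = u"
      using tu(1,2) unfolding ZN_vecs_def by (intro PiE_ext) auto
  qed
  have "(\<Sum>x\<in>ZN_vecs N (Suc m). indicator (paraboloid N (Suc m)) x *
        exp (- 2 * of_real pi * \<i> * of_int (\<Sum>i<Suc m. x i * \<xi> i) / of_nat N)) =
      (\<Sum>x\<in>paraboloid N (Suc m). zchar N (\<Sum>i<Suc m. x i * \<xi> i))"
    using assms paraboloid_subset[of "Suc m" N]
    by (intro sum.mono_neutral_cong_right) (auto simp: zchar_def)
  also have "\<dots> = (\<Sum>t\<in>ZN_vecs N m. zchar N (\<Sum>i<Suc m. ?lift t i * \<xi> i))"
    unfolding P by (simp add: sum.reindex[OF inj])
  also have "\<dots> = (\<Sum>t\<in>ZN_vecs N m. \<Prod>i<m. zchar N (t i * \<xi> i + (t i)\<^sup>2 * \<xi> m))"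
  proof (intro sum.cong refl)
    fix t
    \<comment> \<open>The character does not see the reduction modulo \<open>N\<close> in the last
      coordinate.\<close>
    have "zchar N (\<Sum>i<Suc m. ?lift t i * \<xi> i) =
        zchar N ((\<Sum>i<m. t i * \<xi> i) + (\<Sum>i<m. (t i)\<^sup>2) * \<xi> m)"
      using assms by (intro zchar_cong) (auto intro!: mod_add_cong mod_mult_cong)
    then show "zchar N (\<Sum>i<Suc m. ?lift t i * \<xi> i) =
        (\<Prod>i<m. zchar N (t i * \<xi> i + (t i)\<^sup>2 * \<xi> m))"
      by (simp add: sum_distrib_right flip: zchar_sum sum.distrib)
  qed
  also have "\<dots> = (\<Prod>i<m. gauss_sum N (\<xi> m) (\<xi> i))"
    unfolding gauss_sum_def ZN_vecs_def by (rule prod_sum_PiE [symmetric]) auto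
  finally show ?thesis
    by (simp add: fourier_def)
qed

text \<open>A multiplicative \<open>\<phi>\<close> passes through the product of Gauss sums. The
  cases \<open>\<phi> x = x\<close> and \<open>\<phi> x = x\<^sup>2\<close> serve the L1 and the L2
  norm.\<close>

lemma sum_norm_fourier_paraboloid:
  fixes \<phi> :: "real \<Rightarrow> real"
  assumes "N > 0" and \<phi>: "\<And>x y. x \<ge> 0 \<Longrightarrow> y \<ge> 0 \<Longrightarrow> \<phi> (x * y) = \<phi> x * \<phi> y" "\<phi> 1 = 1"
  shows "(\<Sum>\<xi>\<in>ZN_vecs N (Suc m). \<phi> (cmod (fourier N (Suc m) (indicator (paraboloid N (Suc m))) \<xi>))) =
    \<phi> (real N powr (- real (Suc m) / 2)) *
      (\<Sum>s\<in>{0..<int N}. (\<Sum>\<eta>\<in>{0..<int N}. \<phi> (cmod (gauss_sum N s \<eta>))) ^ m)"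
proof -
  have prod: "\<phi> (\<Prod>i\<in>A. cmod (g i)) = (\<Prod>i\<in>A. \<phi> (cmod (g i)))"
    for A :: "nat set" and g :: "nat \<Rightarrow> complex"
    by (induction A rule: infinite_finite_induct) (simp_all add: \<phi> prod_nonneg)
  show ?thesis
    by (simp add: fourier_indicator_paraboloid assms(1) sum_ZN_vecs_Suc norm_mult prod_norm [symmetric]
      \<phi>(1) prod_nonneg prod sum_distrib_left [symmetric] flip: sum_ZN_vecs_prod)
qed

section \<open>L1 and L2 norms of the transform\<close>

lemma lp_norm_1: "lp_norm N d 1 f = (\<Sum>x\<in>ZN_vecs N d. cmod (f x))"
  by (simp add: lp_norm_def powr_one sum_nonneg)

lemma lp_norm_2: "lp_norm N d 2 f = sqrt (\<Sum>x\<in>ZN_vecs N d. (cmod (f x))\<^sup>2)"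
  by (simp add: lp_norm_def powr_half_sqrt sum_nonneg)

text \<open>Cauchy-Schwarz against the constant 1 on the \<open>N ^ d\<close> frequencies.\<close>

lemma lp_norm_1_le_2:
  assumes "N > 0"
  shows "lp_norm N d 1 f \<le> real N powr (real d / 2) * lp_norm N d 2 f"
proof -
  have "(lp_norm N d 1 f)\<^sup>2 \<le> (\<Sum>x\<in>ZN_vecs N d. (cmod (f x))\<^sup>2) * real (N ^ d)"
    using sum_squared_le_sum_of_squares[of "\<lambda>x. cmod (f x)" "ZN_vecs N d"]
    by (simp add: lp_norm_1 card_ZN_vecs)
  then have "lp_norm N d 1 f \<le> sqrt (real N ^ d) * lp_norm N d 2 f"
    by (simp add: lp_norm_2 real_le_rsqrt mult.commute flip: real_sqrt_mult)
  also have "sqrt (real N ^ d) = real N powr (real d / 2)"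
    using assms by (simp add: powr_half_sqrt_powr powr_realpow)
  finally show ?thesis .
qed

text \<open>Each of the \<open>N\<close> values of \<open>s\<close> contributes
  \<open>((real N)\<^sup>2) ^ m\<close>. After normalisation the squared norm is
  \<open>N ^ m\<close>, the number of points of the paraboloid, as unitarity predicts.\<close>

lemma lp_norm_2_fourier_paraboloid:
  assumes "N > 0"
  shows "lp_norm N (Suc m) 2 (fourier N (Suc m) (indicator (paraboloid N (Suc m)))) =
    real N powr (real m / 2)"
proof -
  have "(\<Sum>\<xi>\<in>ZN_vecs N (Suc m). (cmod (fourier N (Suc m) (indicator (paraboloid N (Suc m))) \<xi>))\<^sup>2) =
      (real N powr (- real (Suc m) / 2))\<^sup>2 * (real N * ((real N)\<^sup>2) ^ m)"
    using sum_norm_fourier_paraboloid[OF assms, of "\<lambda>x. x\<^sup>2" m]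
    by (simp add: power_mult_distrib gauss_sum_parseval[OF assms])
  also have "\<dots> = real N powr (- real (Suc m)) * (real N powr 1 * real N powr (2 * m))"
  proof -
    have "(real N powr (- real (Suc m) / 2))\<^sup>2 = real N powr (- real (Suc m))"
      by (subst powr_power) (use assms in \<open>auto simp del: of_nat_Suc\<close>)
    moreover have "((real N)\<^sup>2) ^ m = real N powr (2 * m)"
      using assms powr_realpow[of "real N" "2 * m"] by (simp add: power_mult)
    ultimately show ?thesis by simp
  qed
  also have "\<dots> = real N powr m"
    unfolding powr_add [symmetric] by simp
  finally show ?thesis
    by (simp add: lp_norm_2 powr_half_sqrt_powr)
qed

text \<open>Totatives lie in 1, ..., N and residues in 0, ..., N - 1. Reduction modulo
  \<open>N\<close> reconciles the two; it moves a totative only for \<open>N = 1\<close>, where 1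
  goes to 0.\<close>

lemma totient_le_card_coprime_residues:
  assumes "N > 0"
  shows "totient N \<le> card {s\<in>{0..<int N}. coprime s (int N)}"
proof -
  have "inj_on (\<lambda>k. int k mod int N) (totatives N)"
  proof (rule inj_onI)
    fix j k assume "j \<in> totatives N" "k \<in> totatives N" "int j mod int N = int k mod int N"
    then have "0 < j" "j \<le> N" "0 < k" "k \<le> N" "j mod N = k mod N"
      by (auto simp: totatives_def simp flip: zmod_int)
    then show "j = k"
      by (metis le_neq_implies_less mod_less mod_self nat_less_le)
  qed
  moreover have "(\<lambda>k. int k mod int N) ` totatives N \<subseteq> {s\<in>{0..<int N}. coprime s (int N)}"
    using assms by (auto simp: totatives_def)
  moreover have "finite {s\<in>{0..<int N}. coprime s (int N)}"
    by (rule finite_subset[of _ "{0..<int N}"]) auto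
  ultimately show ?thesis
    unfolding totient_def by (rule card_inj_on_le)
qed

text \<open>Only the unit frequencies \<open>s\<close> are kept. Each contributes
  \<open>(N * sqrt N) ^ m\<close>, and the exponents add up to -(m + 1)/2 + 3m/2 = m - 1/2.\<close>

lemma lp_norm_1_fourier_paraboloid_ge:
  assumes "odd N"
  shows "real (totient N) * real N powr (real m - 1 / 2) \<le>
    lp_norm N (Suc m) 1 (fourier N (Suc m) (indicator (paraboloid N (Suc m))))"
proof -
  have N: "N > 0" using assms by (rule odd_pos)
  let ?I = "{0..<int N}" and ?U = "{s\<in>{0..<int N}. coprime s (int N)}"
  let ?c = "(real N * sqrt (real N)) ^ m"
  have c: "real N powr (- real (Suc m) / 2) * ?c = real N powr (real m - 1 / 2)"
  proof -
    have "?c = (real N powr 1 * real N powr (1 / 2)) ^ m"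
      by (simp add: powr_half_sqrt)
    also have "\<dots> = real N powr (3 / 2 * real m)"
      using N unfolding powr_add [symmetric] by (simp add: powr_power mult.commute)
    finally show ?thesis
      by (simp only: powr_add [symmetric])
        (rule arg_cong[where f = "(powr) (real N)"], simp add: field_simps)
  qed
  have "real (totient N) * ?c \<le> (\<Sum>s\<in>?U. ?c)"
    using totient_le_card_coprime_residues[OF N] by (simp add: mult_right_mono)
  also have "\<dots> = (\<Sum>s\<in>?U. (\<Sum>\<eta>\<in>?I. cmod (gauss_sum N s \<eta>)) ^ m)"
    using assms by (intro sum.cong refl) (simp add: norm_gauss_sum_coprime)
  also have "\<dots> \<le> (\<Sum>s\<in>?I. (\<Sum>\<eta>\<in>?I. cmod (gauss_sum N s \<eta>)) ^ m)"
    by (intro sum_mono2) (auto simp: sum_nonneg)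
  finally have "real N powr (- real (Suc m) / 2) * (real (totient N) * ?c) \<le>
      lp_norm N (Suc m) 1 (fourier N (Suc m) (indicator (paraboloid N (Suc m))))"
    using sum_norm_fourier_paraboloid[OF N, of "\<lambda>x. x" m]
    by (simp add: lp_norm_1 mult_left_mono)
  then show ?thesis
    unfolding mult.left_commute[of _ "real (totient N)"] c .
qed

section \<open>Lower bound for the totient\<close>

text \<open>The extremal set with k elements is 2, ..., k + 1, for which the product telescopes to
  1/(k + 1). The induction removes the largest element.\<close>

lemma prod_one_minus_inverse_ge:
  fixes A :: "nat set"
  assumes "finite A" "\<And>a. a \<in> A \<Longrightarrow> a \<ge> 2"
  shows "1 / (1 + real (card A)) \<le> (\<Prod>a\<in>A. 1 - 1 / real a)"
  using assms
proof (induction "card A" arbitrary: A)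
  case 0
  then show ?case by simp
next
  case (Suc k)
  then have "A \<noteq> {}" by auto
  define M where "M = Max A"
  have M: "M \<in> A" unfolding M_def using Suc.prems \<open>A \<noteq> {}\<close> by simp
  \<comment> \<open>The k + 1 elements of \<open>A\<close> fit into the M - 1 integers from 2 to
    \<open>M\<close>.\<close>
  have "A \<subseteq> {2..M}" unfolding M_def using Suc.prems by auto
  then have "card A \<le> card {2..M}" by (intro card_mono) auto
  with Suc.hyps Suc.prems(2)[OF M] have k: "k + 2 \<le> M" by simp
  have "1 / (1 + real (card A)) = (1 - 1 / real (k + 2)) * (1 / (1 + real k))"
    using Suc.hyps(2) [symmetric] by (simp add: divide_simps)
  also have "\<dots> \<le> (1 - 1 / real M) * (\<Prod>a\<in>A - {M}. 1 - 1 / real a)"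
  proof (intro mult_mono)
    show "1 / (1 + real k) \<le> (\<Prod>a\<in>A - {M}. 1 - 1 / real a)"
    proof -
      have "card (A - {M}) = k"
        using Suc.hyps(2) Suc.prems(1) M by simp
      then show ?thesis
        using Suc.hyps(1)[of "A - {M}"] Suc.prems by simp
    qed
  qed (use k in \<open>auto simp: frac_le\<close>)
  also have "\<dots> = (\<Prod>a\<in>A. 1 - 1 / real a)"
    using Suc.prems M by (simp add: prod.remove)
  finally show ?case .
qed

lemma two_power_card_prime_factors_le:
  assumes "(N::nat) > 0"
  shows "2 ^ card (prime_factors N) \<le> N"
proof -
  have "2 ^ card (prime_factors N) = (\<Prod>p\<in>prime_factors N. 2::nat)"
    by simp
  also have "\<dots> \<le> (\<Prod>p\<in>prime_factors N. p ^ multiplicity p N)"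
  proof (intro prod_mono conjI)
    fix p assume p: "p \<in> prime_factors N"
    then have "2 \<le> p" "0 < multiplicity p N"
      by (auto simp: prime_ge_2_nat prime_factors_multiplicity)
    then show "2 \<le> p ^ multiplicity p N"
      using self_le_power[of p "multiplicity p N"] by simp
  qed simp
  also have "\<dots> = N"
    using assms by (simp add: prod_prime_factors)
  finally show ?thesis .
qed

text \<open>Euler's product formula, with at most \<open>log 2 N\<close> prime factors. The
  logarithmic loss is absorbed by the factor N^(o(1)).\<close>

lemma totient_ge:
  assumes "N > 0"
  shows "real N / (1 + log 2 (real N)) \<le> real (totient N)"
proof -
  have "real (card (prime_factors N)) \<le> log 2 (real N)"
    by (rule le_log2_of_power[OF two_power_card_prime_factors_le[OF assms]])
  then have "real N * (1 / (1 + log 2 (real N))) \<le> real N * (1 / (1 + real (card (prime_factors N))))"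
    by (intro mult_left_mono frac_le) auto
  also have "\<dots> \<le> real N * (\<Prod>p\<in>prime_factors N. 1 - 1 / real p)"
    by (intro mult_left_mono prod_one_minus_inverse_ge)
      (auto intro: prime_ge_2_nat in_prime_factors_imp_prime)
  finally show ?thesis
    by (simp add: totient_formula2)
qed

section \<open>Bounds for the Fourier ratio and the limit\<close>

lemma FR_paraboloid_bounds:
  assumes "d \<ge> 1" "odd N"
  shows "real N powr (real d / 2) / (1 + log 2 (real N)) \<le> FR N d (indicator (paraboloid N d))"
    and "FR N d (indicator (paraboloid N d)) \<le> real N powr (real d / 2)"
proof -
  obtain m where d: "d = Suc m" using assms(1) by (cases d) auto
  have N: "N > 0" using assms(2) by (rule odd_pos)
  let ?f = "fourier N d (indicator (paraboloid N d))"
  have n2: "lp_norm N d 2 ?f = real N powr (real m / 2)"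
    unfolding d by (rule lp_norm_2_fourier_paraboloid[OF N])
  have "real N powr (real d / 2) / (1 + log 2 (real N)) * lp_norm N d 2 ?f =
      real N / (1 + log 2 (real N)) * real N powr (real m - 1 / 2)"
  proof -
    \<comment> \<open>With d = m + 1 both exponents equal m + 1/2.\<close>
    have "real N powr (real d / 2) * real N powr (real m / 2) = real N powr 1 * real N powr (real m - 1 / 2)"
      unfolding powr_add [symmetric] by (simp add: d field_simps)
    then show ?thesis
      using N by (simp add: n2)
  qed
  also have "\<dots> \<le> real (totient N) * real N powr (real m - 1 / 2)"
    using totient_ge[OF N] by (rule mult_right_mono) simp
  also have "\<dots> \<le> lp_norm N d 1 ?f"
    unfolding d by (rule lp_norm_1_fourier_paraboloid_ge[OF assms(2)])
  finally show "real N powr (real d / 2) / (1 + log 2 (real N)) \<le> FR N d (indicator (paraboloid N d))"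
    using N by (simp add: FR_def n2 pos_le_divide_eq)
  show "FR N d (indicator (paraboloid N d)) \<le> real N powr (real d / 2)"
    using lp_norm_1_le_2[OF N, of d ?f] N by (simp add: FR_def n2 pos_divide_le_eq)
qed

text \<open>The quotient inside the logarithm lies between 1 and \<open>1 + log 2 N\<close>, and
  \<open>N > 1\<close> makes the denominator \<open>ln N\<close> positive.\<close>

lemma kappa_paraboloid_bounds:
  assumes "d \<ge> 1" "odd N" "N > 1"
  shows "0 \<le> kappa N d (indicator (paraboloid N d))"
    and "kappa N d (indicator (paraboloid N d)) \<le> ln (1 + log 2 (real N)) / ln (real N)"
proof -
  let ?R = "FR N d (indicator (paraboloid N d))" and ?Q = "real N powr (real d / 2)"
  note bounds = FR_paraboloid_bounds[OF assms(1,2)]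
  have L: "0 < 1 + log 2 (real N)" using assms(3) by (simp add: add_pos_nonneg)
  have Q: "0 < ?Q" using assms(3) by simp
  then have R: "0 < ?R" using L bounds(1) by (meson divide_pos_pos less_le_trans)
  have lnN: "0 < ln (real N)" using assms(3) by simp
  show "0 \<le> kappa N d (indicator (paraboloid N d))"
    unfolding kappa_def using R lnN bounds(2) by (intro divide_nonneg_pos ln_ge_zero) simp_all
  have "?Q / ?R \<le> 1 + log 2 (real N)"
    using bounds(1) R L by (simp add: divide_simps mult.commute)
  then show "kappa N d (indicator (paraboloid N d)) \<le> ln (1 + log 2 (real N)) / ln (real N)"
    unfolding kappa_def using Q R L lnN by (intro divide_right_mono ln_mono) simp_all
qed

theorem proposition6p3:
  fixes d :: nat and \<N> :: "nat set"
  assumes "d \<ge> 2"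
    and "infinite \<N>"
    and "\<And>N. N \<in> \<N> \<Longrightarrow> odd N"
  shows "(\<exists>\<epsilon> :: nat \<Rightarrow> real.
            (\<epsilon> \<longlongrightarrow> 0) (inf at_top (principal \<N>)) \<and>
            (\<forall>N\<in>\<N>. FR N d (indicator (paraboloid N d)) = real N powr (real d / 2 - \<epsilon> N))) \<and>
         ((\<lambda>N. kappa N d (indicator (paraboloid N d))) \<longlongrightarrow> 0) (inf at_top (principal \<N>))"
proof -
  let ?\<kappa> = "\<lambda>N. kappa N d (indicator (paraboloid N d))"
  have d: "d \<ge> 1" using assms(1) by simp
  have lim: "(?\<kappa> \<longlongrightarrow> 0) (inf at_top (principal \<N>))"
  proof (rule tendsto_sandwich[where f = "\<lambda>_. 0" and h = "\<lambda>N. ln (1 + log 2 (real N)) / ln (real N)"])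
    have ev: "\<forall>\<^sub>F N in inf at_top (principal \<N>). odd N \<and> N > 1"
      unfolding eventually_inf_principal using eventually_gt_at_top[of 1]
      by eventually_elim (use assms(3) in auto)
    show "\<forall>\<^sub>F N in inf at_top (principal \<N>). 0 \<le> ?\<kappa> N"
      using ev by eventually_elim (rule kappa_paraboloid_bounds[OF d]; simp)
    show "\<forall>\<^sub>F N in inf at_top (principal \<N>). ?\<kappa> N \<le> ln (1 + log 2 (real N)) / ln (real N)"
      using ev by eventually_elim (rule kappa_paraboloid_bounds[OF d]; simp)
    \<comment> \<open>The limit is taken over all \<open>N\<close> and then restricted to the
      family, whose filter is finer.\<close>
    have "((\<lambda>N. ln (1 + log 2 (real N)) / ln (real N)) \<longlongrightarrow> 0) at_top"
      by real_asymp
    then show "((\<lambda>N. ln (1 + log 2 (real N)) / ln (real N)) \<longlongrightarrow> 0) (inf at_top (principal \<N>))"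
      by (rule tendsto_mono[rotated]) simp
  qed simp
  \<comment> \<open>The witness for \<open>\<epsilon>\<close> is \<open>kappa\<close> itself, so
    both claims rest on the same limit.\<close>
  have "FR N d (indicator (paraboloid N d)) = real N powr (real d / 2 - ?\<kappa> N)" if "N \<in> \<N>" for N
  proof (cases "N = 1")
    \<comment> \<open>Here \<open>kappa\<close> is a default value, but every power of 1 is 1 and
      the two bounds force the Fourier ratio to be 1.\<close>
    case True
    then show ?thesis
      using FR_paraboloid_bounds[OF d, of N] by simp
  next
    case False
    have N: "odd N" "N > 1"
      using assms(3)[OF that] False by (auto elim!: oddE)
    let ?R = "FR N d (indicator (paraboloid N d))" and ?Q = "real N powr (real d / 2)"
    have "0 < ?Q / (1 + log 2 (real N))"
      using N(2) by (simp add: add_pos_nonneg)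
    then have R: "0 < ?R"
      using FR_paraboloid_bounds(1)[OF d N(1)] by linarith
    have "real N powr ?\<kappa> N = ?Q / ?R"
      using N(2) R by (simp add: kappa_def powr_def)
    then show ?thesis
      using N(2) R by (simp add: powr_diff)
  qed
  with lim show ?thesis by blast
qed

end
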